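(* Let $K$ be a knowledge base (a deductively closed set of formulas of $\mathcal{L}_{\mathcal{P}}$), $\alpha$ a formula, and $IC_K$, $IC_R$ sets of formulas of $\mathcal{L}_{\mathcal{P}}$. Then: (1) $K\dot{+}^{(IC_K,IC_R)}\alpha\vdash IC_R$, i.e. every formula in $IC_R$ is a consequence of $K\dot{+}^{(IC_K,IC_R)}\alpha$. (2) If $IC_R\cup IC_K\not\vdash\neg\alpha$, then $\bigl(K\dot{+}^{(IC_K,IC_R)}\alpha\bigr)\cup IC_K$ is satisfiable.
   Context: $\mathcal{L}_{\mathcal{P}}$ is the classical propositional language over a set $\mathcal{P}$ of atoms, $\vdash$ is classical consequence, and $Cn(\cdot)$ is deductive closure. $\mathcal{P}'=\{p'\mid p\in\mathcal{P}\}$ is a disjoint copy of $\mathcal{P}$. For a set of formulas $K$ of $\mathcal{L}_{\mathcal P}$, $K'$ is the result of replacing each atom $p$ by $p'$. A belief change scenario is a triple $(K,U,V)$ of sets of formulas of $\mathcal{L}_{\mathcal{P}}$. Let $EQ\subseteq\{p\equiv p'\mid p\in\mathcal{P}\}$ be maximal with respect to set inclusion such that $K'\cup EQ\cup U\cup V\not\vdash\bot$. Then $Cn(K'\cup EQ\cup U)\cap\mathcal{L}_{\mathcal{P}}$ is a consistent definitional extension of $(K,U,V)$. Revision with integrity constraints: $K\dot{+}^{(IC_K,IC_R)}\alpha=\bigcap_{i\in I}E_i$, where $(E_i)_{i\in I}$ is the family of all consistent definitional extensions of $(K,\{\alpha\}\cup IC_R,\;IC_K)$; the intersection of the empty family is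 $\mathcal{L}_{\mathcal{P}}$. Here $IC_K$ are the consistency-based constraints and $IC_R$ the entailment-based constraints.
   Formalization: Part (2) is stated for consistent K only: for inconsistent K (K = L_P) there are no consistent definitional extensions, so the revision is L_P, which is unsatisfiable, and (2) as printed fails (e.g. IC_K and IC_R empty, α a tautology). *)

theory Defs
  imports Main
begin

datatype (atoms: 'a) form =
    Atom 'a
  | Bot ("\<bottom>")
  | Neg "'a form"
  | Conj "'a form" "'a form"
  | Disj "'a form" "'a form"
  | Imp "'a form" "'a form"

abbreviation Iff :: "'a form \<Rightarrow> 'a form \<Rightarrow> 'a form" where
  "Iff \<phi> \<psi> \<equiv> Conj (Imp \<phi> \<psi>) (Imp \<psi> \<phi>)"

definition lang :: "'a set \<Rightarrow> 'a form set" where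
  "lang P = {\<phi>. atoms \<phi> \<subseteq> P}"

text \<open>Classical natural deduction, from possibly infinite sets of hypotheses.\<close>

inductive derives :: "'a form set \<Rightarrow> 'a form \<Rightarrow> bool" (infix "\<turnstile>" 50) where
  Hyp:   "\<phi> \<in> \<Gamma> \<Longrightarrow> \<Gamma> \<turnstile> \<phi>"
| Raa:   "insert (Neg \<phi>) \<Gamma> \<turnstile> \<bottom> \<Longrightarrow> \<Gamma> \<turnstile> \<phi>"
| NegI:  "insert \<phi> \<Gamma> \<turnstile> \<bottom> \<Longrightarrow> \<Gamma> \<turnstile> Neg \<phi>"
| NegE:  "\<Gamma> \<turnstile> Neg \<phi> \<Longrightarrow> \<Gamma> \<turnstile> \<phi> \<Longrightarrow> \<Gamma> \<turnstile> \<bottom>"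
| ConjI: "\<Gamma> \<turnstile> \<phi> \<Longrightarrow> \<Gamma> \<turnstile> \<psi> \<Longrightarrow> \<Gamma> \<turnstile> Conj \<phi> \<psi>"
| ConjE1: "\<Gamma> \<turnstile> Conj \<phi> \<psi> \<Longrightarrow> \<Gamma> \<turnstile> \<phi>"
| ConjE2: "\<Gamma> \<turnstile> Conj \<phi> \<psi> \<Longrightarrow> \<Gamma> \<turnstile> \<psi>"
| DisjI1: "\<Gamma> \<turnstile> \<phi> \<Longrightarrow> \<Gamma> \<turnstile> Disj \<phi> \<psi>"
| DisjI2: "\<Gamma> \<turnstile> \<psi> \<Longrightarrow> \<Gamma> \<turnstile> Disj \<phi> \<psi>"
| DisjE: "\<Gamma> \<turnstile> Disj \<phi> \<psi> \<Longrightarrow> insert \<phi> \<Gamma> \<turnstile> \<chi> \<Longrightarrow> insert \<psi> \<Gamma> \<turnstile> \<chi> \<Longrightarrow> \<Gamma> \<turnstile> \<chi>"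
| ImpI:  "insert \<phi> \<Gamma> \<turnstile> \<psi> \<Longrightarrow> \<Gamma> \<turnstile> Imp \<phi> \<psi>"
| ImpE:  "\<Gamma> \<turnstile> Imp \<phi> \<psi> \<Longrightarrow> \<Gamma> \<turnstile> \<phi> \<Longrightarrow> \<Gamma> \<turnstile> \<psi>"

definition Cn :: "'a form set \<Rightarrow> 'a form set" where
  "Cn \<Gamma> = {\<phi>. \<Gamma> \<turnstile> \<phi>}"

primrec holds :: "('a \<Rightarrow> bool) \<Rightarrow> 'a form \<Rightarrow> bool" where
  "holds v (Atom p) = v p"
| "holds v \<bottom> = False"
| "holds v (Neg \<phi>) = (\<not> holds v \<phi>)"
| "holds v (Conj \<phi> \<psi>) = (holds v \<phi> \<and> holds v \<psi>)"
| "holds v (Disj \<phi> \<psi>) = (holds v \<phi> \<or> holds v \<psi>)"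
| "holds v (Imp \<phi> \<psi>) = (holds v \<phi> \<longrightarrow> holds v \<psi>)"

definition satisfiable :: "'a form set \<Rightarrow> bool" where
  "satisfiable \<Gamma> \<longleftrightarrow> (\<exists>v. \<forall>\<phi>\<in>\<Gamma>. holds v \<phi>)"

definition knowledge_base :: "'a set \<Rightarrow> 'a form set \<Rightarrow> bool" where
  "knowledge_base P K \<longleftrightarrow> Cn K \<inter> lang P = K"

text \<open>
  The disjoint copy of the atoms is given by a function \<open>pr\<close> sending \<open>p\<close> to \<open>p'\<close>. It is
  meaningful only if \<open>pr\<close> is injective on \<open>P\<close> and \<open>pr ` P\<close> is disjoint from \<open>P\<close>:
\<close>

definition disjoint_copy :: "'a set \<Rightarrow> ('a \<Rightarrow> 'a) \<Rightarrow> bool" where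
  "disjoint_copy P pr \<longleftrightarrow> inj_on pr P \<and> pr ` P \<inter> P = {}"

definition primed :: "('a \<Rightarrow> 'a) \<Rightarrow> 'a form set \<Rightarrow> 'a form set" where
  "primed pr K = map_form pr ` K"

definition atom_equivs :: "'a set \<Rightarrow> ('a \<Rightarrow> 'a) \<Rightarrow> 'a form set" where
  "atom_equivs P pr = {Iff (Atom p) (Atom (pr p)) | p. p \<in> P}"

definition admissible_EQ ::
  "'a set \<Rightarrow> ('a \<Rightarrow> 'a) \<Rightarrow> 'a form set \<Rightarrow> 'a form set \<Rightarrow> 'a form set \<Rightarrow> 'a form set \<Rightarrow> bool" where
  "admissible_EQ P pr K U V EQ \<longleftrightarrow>
     EQ \<subseteq> atom_equivs P pr \<and> \<not> (primed pr K \<union> EQ \<union> U \<union> V \<turnstile> \<bottom>)"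

definition maximal_EQ ::
  "'a set \<Rightarrow> ('a \<Rightarrow> 'a) \<Rightarrow> 'a form set \<Rightarrow> 'a form set \<Rightarrow> 'a form set \<Rightarrow> 'a form set \<Rightarrow> bool" where
  "maximal_EQ P pr K U V EQ \<longleftrightarrow>
     admissible_EQ P pr K U V EQ \<and>
     (\<forall>EQ'. admissible_EQ P pr K U V EQ' \<and> EQ \<subseteq> EQ' \<longrightarrow> EQ' = EQ)"

definition extensions ::
  "'a set \<Rightarrow> ('a \<Rightarrow> 'a) \<Rightarrow> 'a form set \<Rightarrow> 'a form set \<Rightarrow> 'a form set \<Rightarrow> 'a form set set" where
  "extensions P pr K U V =
     {Cn (primed pr K \<union> EQ \<union> U) \<inter> lang P | EQ. maximal_EQ P pr K U V EQ}"

text \<open>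
  The intersection is taken relative to \<open>lang P\<close>, so that the empty family yields \<open>lang P\<close>;
  every extension is a subset of \<open>lang P\<close> anyway.
\<close>

definition revision ::
  "'a set \<Rightarrow> ('a \<Rightarrow> 'a) \<Rightarrow> 'a form set \<Rightarrow> 'a form set \<Rightarrow> 'a form set \<Rightarrow> 'a form \<Rightarrow> 'a form set" where
  "revision P pr K IC\<^sub>K IC\<^sub>R \<alpha> = lang P \<inter> \<Inter> (extensions P pr K ({\<alpha>} \<union> IC\<^sub>R) IC\<^sub>K)"

text \<open>
  Revising an inconsistent \<open>K\<close> always gives the inconsistent set \<open>lang P\<close>, whatever the
  constraints. Satisfiability of a revision can therefore be claimed for consistent \<open>K\<close> only.
\<close>

lemma derives_mono: "\<Gamma> \<turnstile> \<phi> \<Longrightarrow> \<Gamma> \<subseteq> \<Delta> \<Longrightarrow> \<Delta> \<turnstile> \<phi>"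
proof (induction arbitrary: \<Delta> rule: derives.induct)
  case (DisjE \<Gamma> \<phi> \<psi> \<chi>)
  then show ?case by (meson derives.DisjE insert_mono)
qed (blast intro: derives.intros)+

lemma derives_map: "\<Gamma> \<turnstile> \<phi> \<Longrightarrow> map_form f ` \<Gamma> \<turnstile> map_form f \<phi>"
proof (induction rule: derives.induct)
  case (DisjE \<Gamma> \<phi> \<psi> \<chi>)
  then show ?case by (metis derives.DisjE form.map(5) image_insert)
qed (auto intro: derives.intros)

lemma revision_inconsistent:
  assumes "K \<turnstile> \<bottom>"
  shows "revision P pr K IC\<^sub>K IC\<^sub>R \<alpha> = lang P" "\<not> satisfiable (revision P pr K IC\<^sub>K IC\<^sub>R \<alpha>)"
proof -
  have "primed pr K \<turnstile> \<bottom>"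
    using derives_map[OF assms, of pr] by (simp add: primed_def)
  then have "primed pr K \<union> EQ \<union> U \<union> V \<turnstile> \<bottom>" for EQ U V
    by (rule derives_mono) blast
  then have "extensions P pr K U V = {}" for U V
    by (simp add: extensions_def maximal_EQ_def admissible_EQ_def)
  then show *: "revision P pr K IC\<^sub>K IC\<^sub>R \<alpha> = lang P"
    by (simp add: revision_def)
  have "\<bottom> \<in> lang P"
    by (simp add: lang_def)
  then show "\<not> satisfiable (revision P pr K IC\<^sub>K IC\<^sub>R \<alpha>)"
    unfolding * satisfiable_def by force
qed

end

theory Submission
  imports Defs
begin

text \<open>
  A model of the consistent \<open>K\<close>, read on the primed atoms, and a model of
  \<open>{\<alpha>} \<union> IC\<^sub>R \<union> IC\<^sub>K\<close>, read on \<open>P\<close>, combine to a single model of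
  \<open>K' \<union> {\<alpha>} \<union> IC\<^sub>R \<union> IC\<^sub>K\<close>. So the empty set of equivalences is admissible, and Zorn's lemma
  yields a maximal one. A model of the corresponding consistent set satisfies both
  \<open>IC\<^sub>K\<close> and the extension, which contains the revision.
\<close>

section \<open>Soundness, compactness and completeness of the calculus\<close>

lemma derives_sound: "\<Gamma> \<turnstile> \<phi> \<Longrightarrow> \<forall>\<psi>\<in>\<Gamma>. holds v \<psi> \<Longrightarrow> holds v \<phi>"
  by (induction rule: derives.induct) auto

lemma satisfiable_consistent: "satisfiable \<Gamma> \<Longrightarrow> \<not> \<Gamma> \<turnstile> \<bottom>"
  unfolding satisfiable_def using derives_sound by fastforce

text \<open>Brings a derivation into the shape expected by the rules that discharge \<phi>, whether
  or not \<phi> occurs among its premises.\<close>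

lemma derives_insert_Diff:
  assumes "\<Gamma> \<turnstile> \<psi>"
  shows "insert \<phi> (\<Gamma> - {\<phi>}) \<turnstile> \<psi>"
  using assms by (rule derives_mono) blast

text \<open>Compactness, by induction on the derivation: each rule merges the finite premise sets of
  its subderivations and removes the discharged formula. It drives the chain argument for Zorn's
  lemma.\<close>

lemma derives_finite:
  "\<Gamma> \<turnstile> \<phi> \<Longrightarrow> \<exists>\<Gamma>\<^sub>0. finite \<Gamma>\<^sub>0 \<and> \<Gamma>\<^sub>0 \<subseteq> \<Gamma> \<and> \<Gamma>\<^sub>0 \<turnstile> \<phi>"
proof (induction rule: derives.induct)
  case (Hyp \<phi> \<Gamma>)
  then have "finite {\<phi>} \<and> {\<phi>} \<subseteq> \<Gamma> \<and> {\<phi>} \<turnstile> \<phi>"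
    by (simp add: derives.Hyp)
  then show ?case by blast
next
  case (Raa \<phi> \<Gamma>)
  then obtain F where "finite F" "F \<subseteq> insert (Neg \<phi>) \<Gamma>" "F \<turnstile> \<bottom>" by blast
  then have "finite (F - {Neg \<phi>}) \<and> F - {Neg \<phi>} \<subseteq> \<Gamma> \<and> F - {Neg \<phi>} \<turnstile> \<phi>"
    using derives.Raa[OF derives_insert_Diff] by auto
  then show ?case by blast
next
  case (NegI \<phi> \<Gamma>)
  then obtain F where "finite F" "F \<subseteq> insert \<phi> \<Gamma>" "F \<turnstile> \<bottom>" by blast
  then have "finite (F - {\<phi>}) \<and> F - {\<phi>} \<subseteq> \<Gamma> \<and> F - {\<phi>} \<turnstile> Neg \<phi>"
    using derives.NegI[OF derives_insert_Diff] by auto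
  then show ?case by blast
next
  case (NegE \<Gamma> \<phi>)
  then obtain F G where "finite F" "F \<subseteq> \<Gamma>" "F \<turnstile> Neg \<phi>" "finite G" "G \<subseteq> \<Gamma>" "G \<turnstile> \<phi>"
    by blast
  then have "finite (F \<union> G) \<and> F \<union> G \<subseteq> \<Gamma> \<and> F \<union> G \<turnstile> \<bottom>"
    using derives_mono[of F _ "F \<union> G"] derives_mono[of G _ "F \<union> G"]
    by (simp add: derives.NegE[of _ \<phi>])
  then show ?case by blast
next
  case (ConjI \<Gamma> \<phi> \<psi>)
  then obtain F G where "finite F" "F \<subseteq> \<Gamma>" "F \<turnstile> \<phi>" "finite G" "G \<subseteq> \<Gamma>" "G \<turnstile> \<psi>"
    by blast
  then have "finite (F \<union> G) \<and> F \<union> G \<subseteq> \<Gamma> \<and> F \<union> G \<turnstile> Conj \<phi> \<psi>"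
    using derives_mono[of F _ "F \<union> G"] derives_mono[of G _ "F \<union> G"]
    by (simp add: derives.ConjI)
  then show ?case by blast
next
  case (DisjE \<Gamma> \<phi> \<psi> \<chi>)
  then obtain F G H where F: "finite F" "F \<subseteq> \<Gamma>" "F \<turnstile> Disj \<phi> \<psi>"
    and G: "finite G" "G \<subseteq> insert \<phi> \<Gamma>" "G \<turnstile> \<chi>"
    and H: "finite H" "H \<subseteq> insert \<psi> \<Gamma>" "H \<turnstile> \<chi>"
    by blast
  \<comment> \<open>The case hypotheses \<phi> and \<psi> are removed so that the set stays within
    \<Gamma>; inserting either one again recovers \<open>G\<close> or \<open>H\<close>.\<close>
  let ?F = "F \<union> (G - {\<phi>}) \<union> (H - {\<psi>})"
  have "?F \<turnstile> Disj \<phi> \<psi>" "insert \<phi> ?F \<turnstile> \<chi>" "insert \<psi> ?F \<turnstile> \<chi>"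
    by (rule derives_mono[OF F(3)] derives_mono[OF G(3)] derives_mono[OF H(3)]; blast)+
  then have "?F \<turnstile> \<chi>"
    by (rule derives.DisjE)
  moreover have "finite ?F" "?F \<subseteq> \<Gamma>"
    using F(1,2) G(1,2) H(1,2) by auto
  ultimately show ?case
    by (intro exI[of _ ?F] conjI)
next
  case (ImpI \<phi> \<Gamma> \<psi>)
  then obtain F where "finite F" "F \<subseteq> insert \<phi> \<Gamma>" "F \<turnstile> \<psi>" by blast
  then have "finite (F - {\<phi>}) \<and> F - {\<phi>} \<subseteq> \<Gamma> \<and> F - {\<phi>} \<turnstile> Imp \<phi> \<psi>"
    using derives.ImpI[OF derives_insert_Diff] by auto
  then show ?case by blast
next
  case (ImpE \<Gamma> \<phi> \<psi>)
  then obtain F G where "finite F" "F \<subseteq> \<Gamma>" "F \<turnstile> Imp \<phi> \<psi>" "finite G" "G \<subseteq> \<Gamma>" "G \<turnstile> \<phi>"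
    by blast
  then have "finite (F \<union> G) \<and> F \<union> G \<subseteq> \<Gamma> \<and> F \<union> G \<turnstile> \<psi>"
    using derives_mono[of F _ "F \<union> G"] derives_mono[of G _ "F \<union> G"]
    by (simp add: derives.ImpE[of _ \<phi>])
  then show ?case by blast
qed (meson derives.ConjE1 derives.ConjE2 derives.DisjI1 derives.DisjI2)+

text \<open>By compactness, an inconsistency of \<Gamma> with the union of a nonempty chain already
  occurs at one member, so Zorn's lemma applies. The bound \<open>A\<close> lets one argument serve
  both Lindenbaum's lemma (\<open>A = UNIV\<close>) and the choice of equivalences
  (\<open>A = atom_equivs P pr\<close>).\<close>

lemma maximal_consistent_subset:
  assumes "\<not> \<Gamma> \<turnstile> \<bottom>"
  obtains M where "M \<subseteq> A" "\<not> \<Gamma> \<union> M \<turnstile> \<bottom>"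
    and "\<And>N. N \<subseteq> A \<Longrightarrow> \<not> \<Gamma> \<union> N \<turnstile> \<bottom> \<Longrightarrow> M \<subseteq> N \<Longrightarrow> N = M"
proof -
  let ?S = "{M. M \<subseteq> A \<and> \<not> \<Gamma> \<union> M \<turnstile> \<bottom>}"
  have "\<exists>M\<in>?S. \<forall>N\<in>?S. M \<subseteq> N \<longrightarrow> N = M"
  proof (rule subset_Zorn_nonempty)
    have "{} \<in> ?S"
      using assms by simp
    then show "?S \<noteq> {}"
      by (metis empty_iff)
  next
    fix C assume C: "C \<noteq> {}" "subset.chain ?S C"
    have "\<not> \<Gamma> \<union> \<Union>C \<turnstile> \<bottom>"
    proof
      assume "\<Gamma> \<union> \<Union>C \<turnstile> \<bottom>"
      then obtain F where F: "finite F" "F \<subseteq> \<Gamma> \<union> \<Union>C" "F \<turnstile> \<bottom>"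
        using derives_finite by blast
      \<comment> \<open>Only the premises outside \<Gamma> must come from the chain; being finitely
        many, they all lie in one member \<open>B\<close>.\<close>
      then have "finite (F - \<Gamma>)" "F - \<Gamma> \<subseteq> \<Union>C" by auto
      then obtain B where B: "B \<in> C" "F - \<Gamma> \<subseteq> B"
        using C finite_subset_Union_chain by blast
      then have "\<Gamma> \<union> B \<turnstile> \<bottom>"
        using derives_mono[OF F(3)] by blast
      with B(1) C(2) show False
        by (auto simp: subset_chain_def)
    qed
    with C(2) show "\<Union>C \<in> ?S"
      by (auto simp: subset_chain_def)
  qed
  then obtain M where "M \<in> ?S" "\<forall>N\<in>?S. M \<subseteq> N \<longrightarrow> N = M" ..
  then show thesis
    by (intro that[of M]) simp_all
qed

text \<open>Completeness by Lindenbaum's construction: membership in a maximal consistent set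
  commutes with the connectives, so its atoms define a model.\<close>

lemma consistent_satisfiable:
  assumes "\<not> \<Gamma> \<turnstile> \<bottom>"
  shows "satisfiable \<Gamma>"
proof -
  obtain M where con: "\<not> \<Gamma> \<union> M \<turnstile> \<bottom>"
    and max: "\<And>N. \<not> \<Gamma> \<union> N \<turnstile> \<bottom> \<Longrightarrow> M \<subseteq> N \<Longrightarrow> N = M"
    using maximal_consistent_subset[OF assms, of UNIV] by auto
  \<comment> \<open>Adding \<Gamma> to \<open>M\<close> changes nothing in the consistency
    condition, so maximality forces \<Gamma> into \<open>M\<close>.\<close>
  have "\<Gamma> \<union> (\<Gamma> \<union> M) = \<Gamma> \<union> M" by blast
  then have sub: "\<Gamma> \<subseteq> M"
    using max[of "\<Gamma> \<union> M"] con by auto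
  then have un: "\<Gamma> \<union> N = N" if "M \<subseteq> N" for N
    using that by blast
  have con: "\<not> M \<turnstile> \<bottom>"
    using con un by simp
  have ins: "insert \<phi> M \<turnstile> \<bottom>" if "\<phi> \<notin> M" for \<phi>
    using max[of "insert \<phi> M"] un[of "insert \<phi> M"] that by auto
  have closed: "\<phi> \<in> M" if "M \<turnstile> \<phi>" for \<phi>
    using ins derives.NegI derives.NegE that con by blast
  have neg: "Neg \<phi> \<in> M \<longleftrightarrow> \<phi> \<notin> M" for \<phi>
    using ins derives.NegI derives.NegE derives.Hyp closed con by metis
  have conj: "Conj \<phi> \<psi> \<in> M \<longleftrightarrow> \<phi> \<in> M \<and> \<psi> \<in> M" for \<phi> \<psi>
    using derives.ConjI derives.ConjE1 derives.ConjE2 derives.Hyp closed by metis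
  have disj: "Disj \<phi> \<psi> \<in> M \<longleftrightarrow> \<phi> \<in> M \<or> \<psi> \<in> M" for \<phi> \<psi>
    using derives.DisjI1 derives.DisjI2 derives.DisjE derives.Hyp closed ins con by metis
  have imp: "Imp \<phi> \<psi> \<in> M \<longleftrightarrow> (\<phi> \<in> M \<longrightarrow> \<psi> \<in> M)" for \<phi> \<psi>
  proof
    assume "Imp \<phi> \<psi> \<in> M"
    then show "\<phi> \<in> M \<longrightarrow> \<psi> \<in> M"
      using derives.ImpE derives.Hyp closed by metis
  next
    assume *: "\<phi> \<in> M \<longrightarrow> \<psi> \<in> M"
    have "insert \<phi> M \<turnstile> \<psi>"
    proof (cases "\<phi> \<in> M")
      case True
      with * show ?thesis by (simp add: derives.Hyp)
    next
      case False
      \<comment> \<open>Ex falso: \<open>insert \<phi> M\<close> is already inconsistent, so any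
        \<psi> follows by reductio.\<close>
      from ins[OF this] have "insert (Neg \<psi>) (insert \<phi> M) \<turnstile> \<bottom>"
        by (rule derives_mono) blast
      then show ?thesis by (rule derives.Raa)
    qed
    then show "Imp \<phi> \<psi> \<in> M"
      by (intro closed derives.ImpI)
  qed
  have "\<bottom> \<notin> M"
    using con derives.Hyp by blast
  \<comment> \<open>Truth lemma: the valuation read off from the atoms in \<open>M\<close> makes
    exactly the members of \<open>M\<close> true.\<close>
  then have "holds (\<lambda>p. Atom p \<in> M) \<phi> \<longleftrightarrow> \<phi> \<in> M" for \<phi>
    by (induction \<phi>) (simp_all add: neg conj disj imp)
  with sub show ?thesis
    unfolding satisfiable_def by blast
qed

section \<open>Models of primed knowledge bases and of extensions\<close>

lemma holds_cong: "(\<And>p. p \<in> atoms \<phi> \<Longrightarrow> v p = w p) \<Longrightarrow> holds v \<phi> \<longleftrightarrow> holds w \<phi>"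
  by (induction \<phi>) auto

lemma holds_map_form: "holds v (map_form f \<phi>) \<longleftrightarrow> holds (v \<circ> f) \<phi>"
  by (induction \<phi>) auto

lemma satisfiable_primed_Un:
  assumes copy: "disjoint_copy P pr"
    and "K \<subseteq> lang P" "\<Gamma> \<subseteq> lang P" "satisfiable K" "satisfiable \<Gamma>"
  shows "satisfiable (primed pr K \<union> \<Gamma>)"
proof -
  obtain v w where v: "\<forall>\<phi>\<in>K. holds v \<phi>" and w: "\<forall>\<phi>\<in>\<Gamma>. holds w \<phi>"
    using assms unfolding satisfiable_def by blast
  \<comment> \<open>Injectivity lets \<open>inv_into P pr\<close> undo the priming, and disjointness
    sends every \<open>pr p\<close> with \<open>p \<in> P\<close> to the second branch.\<close>
  define u where "u a = (if a \<in> P then w a else v (inv_into P pr a))" for a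
  have "holds u (map_form pr \<phi>)" if "\<phi> \<in> K" for \<phi>
  proof -
    have "(u \<circ> pr) p = v p" if "p \<in> P" for p
      using copy that by (auto simp: u_def disjoint_copy_def)
    then have "holds (u \<circ> pr) \<phi> \<longleftrightarrow> holds v \<phi>"
      using that assms(2) by (intro holds_cong) (auto simp: lang_def)
    with v that show ?thesis
      by (simp add: holds_map_form)
  qed
  moreover have "holds u \<phi>" if "\<phi> \<in> \<Gamma>" for \<phi>
  proof -
    have "holds u \<phi> \<longleftrightarrow> holds w \<phi>"
      using that assms(3) by (intro holds_cong) (auto simp: u_def lang_def)
    with w that show ?thesis
      by simp
  qed
  ultimately show ?thesis
    unfolding satisfiable_def primed_def
    by blast
qed

text \<open>The hypothesis says that the empty set of equivalences is admissible; it is then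
  enlarged to a maximal one over the fixed premises.\<close>

lemma maximal_EQ_exists:
  assumes "\<not> primed pr K \<union> U \<union> V \<turnstile> \<bottom>"
  obtains EQ where "maximal_EQ P pr K U V EQ"
proof -
  obtain EQ where "EQ \<subseteq> atom_equivs P pr" "\<not> primed pr K \<union> U \<union> V \<union> EQ \<turnstile> \<bottom>"
    and "\<And>E. E \<subseteq> atom_equivs P pr \<Longrightarrow> \<not> primed pr K \<union> U \<union> V \<union> E \<turnstile> \<bottom> \<Longrightarrow> EQ \<subseteq> E \<Longrightarrow> E = EQ"
    using maximal_consistent_subset[OF assms, of "atom_equivs P pr"] by metis
  moreover have "primed pr K \<union> U \<union> V \<union> E = primed pr K \<union> E \<union> U \<union> V" for E
    by blast
  ultimately have "maximal_EQ P pr K U V EQ"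
    by (simp add: maximal_EQ_def admissible_EQ_def)
  then show thesis
    by (rule that)
qed

text \<open>\<open>V\<close> is not a premise of \<open>E\<close>, but \<open>EQ\<close> was chosen
  consistent with it: a model of all the formulas together satisfies \<open>V\<close>, and by
  soundness also \<open>E\<close>.\<close>

lemma extension_satisfiable:
  assumes "E \<in> extensions P pr K U V"
  shows "satisfiable (E \<union> V)"
proof -
  obtain EQ where E: "E = Cn (primed pr K \<union> EQ \<union> U) \<inter> lang P"
    and "maximal_EQ P pr K U V EQ"
    using assms unfolding extensions_def by blast
  then have "satisfiable (primed pr K \<union> EQ \<union> U \<union> V)"
    by (simp add: maximal_EQ_def admissible_EQ_def consistent_satisfiable)
  then obtain v where v: "\<forall>\<phi>\<in>primed pr K \<union> EQ \<union> U \<union> V. holds v \<phi>"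
    unfolding satisfiable_def by blast
  then have "\<forall>\<phi>\<in>E. holds v \<phi>"
    unfolding E Cn_def using derives_sound[of "primed pr K \<union> EQ \<union> U"] by blast
  with v show ?thesis
    unfolding satisfiable_def by blast
qed

theorem theorem7:
  fixes P :: "'a set" and pr :: "'a \<Rightarrow> 'a"
    and K IC\<^sub>K IC\<^sub>R :: "'a form set" and \<alpha> :: "'a form"
  assumes "disjoint_copy P pr"
    and "knowledge_base P K"
    and "\<alpha> \<in> lang P"
    and "IC\<^sub>K \<subseteq> lang P" and "IC\<^sub>R \<subseteq> lang P"
  shows "(\<forall>\<phi>\<in>IC\<^sub>R. revision P pr K IC\<^sub>K IC\<^sub>R \<alpha> \<turnstile> \<phi>) \<and>
    (\<not> (K \<turnstile> \<bottom>) \<longrightarrow> \<not> (IC\<^sub>R \<union> IC\<^sub>K \<turnstile> Neg \<alpha>) \<longrightarrow>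
       satisfiable (revision P pr K IC\<^sub>K IC\<^sub>R \<alpha> \<union> IC\<^sub>K))"
proof (intro conjI ballI impI)
  \<comment> \<open>Each \<phi> in \<open>IC\<^sub>R\<close> lies in \<open>lang P\<close> and is a
    premise of every extension, hence belongs to the revision even if there are no
    extensions.\<close>
  fix \<phi> assume "\<phi> \<in> IC\<^sub>R"
  with assms(5) have "\<phi> \<in> revision P pr K IC\<^sub>K IC\<^sub>R \<alpha>"
    by (auto simp: revision_def extensions_def Cn_def intro: derives.Hyp)
  then show "revision P pr K IC\<^sub>K IC\<^sub>R \<alpha> \<turnstile> \<phi>"
    by (rule derives.Hyp)
next
  assume K: "\<not> K \<turnstile> \<bottom>" and IC: "\<not> IC\<^sub>R \<union> IC\<^sub>K \<turnstile> Neg \<alpha>"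
  let ?U = "{\<alpha>} \<union> IC\<^sub>R"
  \<comment> \<open>Otherwise negation introduction would discharge \<alpha> and derive
    \<open>Neg \<alpha>\<close> from the constraints.\<close>
  have "\<not> ?U \<union> IC\<^sub>K \<turnstile> \<bottom>"
    using IC derives.NegI[of \<alpha> "IC\<^sub>R \<union> IC\<^sub>K"] by auto
  moreover have "K \<subseteq> lang P"
    using assms(2) by (auto simp: knowledge_base_def)
  moreover have "?U \<union> IC\<^sub>K \<subseteq> lang P"
    using assms(3-5) by auto
  ultimately have "satisfiable (primed pr K \<union> (?U \<union> IC\<^sub>K))"
    using assms(1) K by (intro satisfiable_primed_Un consistent_satisfiable)
  then have "\<not> primed pr K \<union> ?U \<union> IC\<^sub>K \<turnstile> \<bottom>"
    by (simp add: satisfiable_consistent Un_assoc)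
  then obtain EQ where "maximal_EQ P pr K ?U IC\<^sub>K EQ"
    by (rule maximal_EQ_exists)
  \<comment> \<open>The family of extensions is nonempty, so the revision lies inside a single
    \<open>E\<close> and inherits its model.\<close>
  then obtain E where E: "E \<in> extensions P pr K ?U IC\<^sub>K"
    unfolding extensions_def by blast
  then have "revision P pr K IC\<^sub>K IC\<^sub>R \<alpha> \<subseteq> E"
    unfolding revision_def by blast
  with extension_satisfiable[OF E] show "satisfiable (revision P pr K IC\<^sub>K IC\<^sub>R \<alpha> \<union> IC\<^sub>K)"
    unfolding satisfiable_def by blast
qed

end
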